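(* Let $D\subset\mathbb R^d$ be open and let $A_\eta(\omega)$, $A$ be compact self-adjoint operators on $L^2(D)$ as in the context, with $\mathbb E\|A_\eta-A\|^2\lesssim\eta^2$. Let $Au_n=\lambda_nu_n$ with $\|u_n\|=1$, and let $A_\eta u_n^\eta=\lambda_n^\eta u_n^\eta$ with $\|u_n^\eta\|=1$, labelled so that $\mathbb E\{|\lambda_n-\lambda_n^\eta|^2\}+\mathbb E\{\|u_n^\eta-u_n\|^2\}\lesssim\eta^2$. Assume that there is a deterministic kernel $\sigma_n(\mathbf x,\mathbf y)$ such that, for every sufficiently smooth function $M$ on $D$, $$\Big(M,\frac{A_\eta-A}{\eta}u_n\Big)\ \longrightarrow\ \int_{D^2}M(\mathbf x)\sigma_n(\mathbf x,\mathbf y)\,dW_{\mathbf y}\,d\mathbf x\qquad\text{in distribution as }\eta\to0,$$ where $dW_{\mathbf y}$ is standard white noise on $D$, and that the eigenvectors of $A$ are sufficiently smooth that $M$ may be taken to be any of them. Then, as $\eta\to0$, $$\frac{\lambda_n^\eta-\lambda_n}{\eta}\ \longrightarrow\ \int_{D^2}u_n(\mathbf x)\sigma_n(\mathbf x,\mathbf y)\,dW_{\mathbf y}\,d\mathbf x\qquad\text{in distribution},$$ and, for every eigenvector $u_m$ of $A$ with eigenvalue $\lambda_m\ne\lambda_n$, $$\Big(\frac{u_n^\eta-u_n}{\eta},u_m\Big)\ \longrightarrow\ \frac1{\lambda_n-\lambda_m}\int_{D^2}u_m(\mathbf x)\sigma_n(\mathbf x,\mathbf y)\,dW_{\mathbf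 y}\,d\mathbf x\qquad\text{in distribution}.$$
   Context: For $\eta>0$ and $\omega$ in a probability space $(\Omega,\mathcal F,\mathbb P)$, $A_\eta(\omega)$ are compact self-adjoint operators on $L^2(D)$, bounded uniformly in $\eta$ and ($\mathbb P$-a.s.) in $\omega$; $A$ is a deterministic compact self-adjoint operator on $L^2(D)$. $\|\cdot\|$ denotes the $L^2(D)$ norm or the corresponding operator norm, $(\cdot,\cdot)$ the (real) $L^2(D)$ inner product. $\alpha\lesssim\beta$ means $\alpha\le C\beta$ with $C$ independent of $\eta$. Integrals $\int_{D^2}M(\mathbf x)\sigma_n(\mathbf x,\mathbf y)\,dW_{\mathbf y}d\mathbf x$ are understood as the Wiener integrals $\int_D\big(\int_DM(\mathbf x)\sigma_n(\mathbf x,\mathbf y)d\mathbf x\big)dW_{\mathbf y}$, with square-integrable integrand in $\mathbf y$. *)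

theory Defs
  imports "HOL-Probability.Probability"
begin

section \<open>The real space \<open>L\<^sup>2(D)\<close>\<close>

text \<open>Elements of \<open>L\<^sup>2(D)\<close> are represented by square-integrable functions, and equality in
  \<open>L\<^sup>2(D)\<close> is equality almost everywhere on \<open>D\<close>. Values outside \<open>D\<close> are irrelevant.\<close>

definition L2 :: "'a::euclidean_space set \<Rightarrow> ('a \<Rightarrow> real) set" where
  "L2 D = {f. f \<in> borel_measurable (lebesgue_on D) \<and>
              integrable (lebesgue_on D) (\<lambda>x. (f x)\<^sup>2)}"

definition L2_inner :: "'a::euclidean_space set \<Rightarrow> ('a \<Rightarrow> real) \<Rightarrow> ('a \<Rightarrow> real) \<Rightarrow> real" where
  "L2_inner D f g = (LINT x|lebesgue_on D. f x * g x)"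

definition L2_norm :: "'a::euclidean_space set \<Rightarrow> ('a \<Rightarrow> real) \<Rightarrow> real" where
  "L2_norm D f = sqrt (L2_inner D f f)"

definition L2_eq :: "'a::euclidean_space set \<Rightarrow> ('a \<Rightarrow> real) \<Rightarrow> ('a \<Rightarrow> real) \<Rightarrow> bool" where
  "L2_eq D f g \<longleftrightarrow> (AE x in lebesgue_on D. f x = g x)"

section \<open>Operators on \<open>L\<^sup>2(D)\<close>\<close>

text \<open>Linearity is required up to \<^const>\<open>L2_eq\<close>. Together with boundedness it implies that the
  operator respects \<^const>\<open>L2_eq\<close>, hence acts on classes.\<close>

definition L2_bounded_linear ::
    "'a::euclidean_space set \<Rightarrow> (('a \<Rightarrow> real) \<Rightarrow> ('a \<Rightarrow> real)) \<Rightarrow> bool" where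
  "L2_bounded_linear D T \<longleftrightarrow>
     (\<forall>f\<in>L2 D. T f \<in> L2 D) \<and>
     (\<forall>f\<in>L2 D. \<forall>g\<in>L2 D. \<forall>a b::real.
        L2_eq D (T (\<lambda>x. a * f x + b * g x)) (\<lambda>x. a * T f x + b * T g x)) \<and>
     (\<exists>C. \<forall>f\<in>L2 D. L2_norm D (T f) \<le> C * L2_norm D f)"

definition L2_compact ::
    "'a::euclidean_space set \<Rightarrow> (('a \<Rightarrow> real) \<Rightarrow> ('a \<Rightarrow> real)) \<Rightarrow> bool" where
  "L2_compact D T \<longleftrightarrow> L2_bounded_linear D T \<and>
     (\<forall>f :: nat \<Rightarrow> 'a \<Rightarrow> real. (\<forall>k. f k \<in> L2 D) \<and> (\<exists>B. \<forall>k. L2_norm D (f k) \<le> B) \<longrightarrow>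
        (\<exists>r :: nat \<Rightarrow> nat. \<exists>g\<in>L2 D. strict_mono r \<and>
           (\<lambda>k. L2_norm D (\<lambda>x. T (f (r k)) x - g x)) \<longlonglongrightarrow> 0))"

definition L2_self_adjoint ::
    "'a::euclidean_space set \<Rightarrow> (('a \<Rightarrow> real) \<Rightarrow> ('a \<Rightarrow> real)) \<Rightarrow> bool" where
  "L2_self_adjoint D T \<longleftrightarrow> (\<forall>f\<in>L2 D. \<forall>g\<in>L2 D. L2_inner D (T f) g = L2_inner D f (T g))"

definition L2_opnorm ::
    "'a::euclidean_space set \<Rightarrow> (('a \<Rightarrow> real) \<Rightarrow> ('a \<Rightarrow> real)) \<Rightarrow> real" where
  "L2_opnorm D T = (SUP f\<in>{f \<in> L2 D. L2_norm D f \<le> 1}. L2_norm D (T f))"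

definition L2_eigen ::
    "'a::euclidean_space set \<Rightarrow> (('a \<Rightarrow> real) \<Rightarrow> ('a \<Rightarrow> real)) \<Rightarrow> real \<Rightarrow> ('a \<Rightarrow> real) \<Rightarrow> bool" where
  "L2_eigen D T l u \<longleftrightarrow> u \<in> L2 D \<and> L2_norm D u \<noteq> 0 \<and> L2_eq D (T u) (\<lambda>x. l * u x)"

section \<open>Random elements and random operators\<close>

text \<open>Since \<open>L\<^sup>2(D)\<close> is separable, weak and strong measurability coincide.\<close>

definition L2_random_element ::
    "'a::euclidean_space set \<Rightarrow> 'w measure \<Rightarrow> ('w \<Rightarrow> 'a \<Rightarrow> real) \<Rightarrow> bool" where
  "L2_random_element D P U \<longleftrightarrow> (\<forall>\<omega>\<in>space P. U \<omega> \<in> L2 D) \<and>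
     (\<forall>f\<in>L2 D. (\<lambda>\<omega>. L2_inner D f (U \<omega>)) \<in> borel_measurable P)"

definition L2_random_operator ::
    "'a::euclidean_space set \<Rightarrow> 'w measure \<Rightarrow> ('w \<Rightarrow> ('a \<Rightarrow> real) \<Rightarrow> ('a \<Rightarrow> real)) \<Rightarrow> bool" where
  "L2_random_operator D P T \<longleftrightarrow> (\<forall>f\<in>L2 D. L2_random_element D P (\<lambda>\<omega>. T \<omega> f))"

section \<open>White noise and the Wiener integral\<close>

text \<open>Constants count as (degenerate) Gaussian variables.\<close>

definition gaussian_rv :: "'v measure \<Rightarrow> ('v \<Rightarrow> real) \<Rightarrow> bool" where
  "gaussian_rv Q X \<longleftrightarrow> X \<in> borel_measurable Q \<and>
     ((\<exists>m s. s > 0 \<and> distributed Q lborel X (normal_density m s)) \<or>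
      (\<exists>c. AE v in Q. X v = c))"

text \<open>Standard white noise on \<open>D\<close> as the isonormal Gaussian process over \<open>L\<^sup>2(D)\<close>: a centred
  Gaussian family indexed by \<open>L\<^sup>2(D)\<close> whose covariance is the inner product. The noise of a Borel
  set \<open>B \<subseteq> D\<close> of finite volume is \<open>W (indicator B)\<close>, and for \<open>g \<in> L\<^sup>2(D)\<close> the variable \<open>W g\<close> is
  the Wiener integral \<open>\<integral>\<^sub>D g(y) dW\<^sub>y\<close> (the covariance makes \<open>W\<close> a linear isometry up to null
  sets).\<close>

definition white_noise ::
    "'a::euclidean_space set \<Rightarrow> 'v measure \<Rightarrow> (('a \<Rightarrow> real) \<Rightarrow> 'v \<Rightarrow> real) \<Rightarrow> bool" where
  "white_noise D Q W \<longleftrightarrow> prob_space Q \<and>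
     (\<forall>(n::nat) (c :: nat \<Rightarrow> real) f. (\<forall>i<n. f i \<in> L2 D) \<longrightarrow>
        gaussian_rv Q (\<lambda>v. \<Sum>i<n. c i * W (f i) v)) \<and>
     (\<forall>g\<in>L2 D. (LINT v|Q. W g v) = 0) \<and>
     (\<forall>f\<in>L2 D. \<forall>g\<in>L2 D. (LINT v|Q. W f v * W g v) = L2_inner D f g)"

definition kernel_integral ::
    "'a::euclidean_space set \<Rightarrow> ('a \<Rightarrow> 'a \<Rightarrow> real) \<Rightarrow> ('a \<Rightarrow> real) \<Rightarrow> 'a \<Rightarrow> real" where
  "kernel_integral D \<sigma> M = (\<lambda>y. LINT x|lebesgue_on D. M x * \<sigma> x y)"

text \<open>Well-definedness of \<open>\<integral>\<^sub>D (\<integral>\<^sub>D M(x) \<sigma>(x,y) dx) dW\<^sub>y\<close>.\<close>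

definition kernel_integrand_ok ::
    "'a::euclidean_space set \<Rightarrow> ('a \<Rightarrow> 'a \<Rightarrow> real) \<Rightarrow> ('a \<Rightarrow> real) \<Rightarrow> bool" where
  "kernel_integrand_ok D \<sigma> M \<longleftrightarrow>
     (AE y in lebesgue_on D. integrable (lebesgue_on D) (\<lambda>x. M x * \<sigma> x y)) \<and>
     kernel_integral D \<sigma> M \<in> L2 D"

definition noise_integral ::
    "'a::euclidean_space set \<Rightarrow> (('a \<Rightarrow> real) \<Rightarrow> 'v \<Rightarrow> real) \<Rightarrow> ('a \<Rightarrow> 'a \<Rightarrow> real) \<Rightarrow>
     ('a \<Rightarrow> real) \<Rightarrow> 'v \<Rightarrow> real" where
  "noise_integral D W \<sigma> M = W (kernel_integral D \<sigma> M)"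

section \<open>Convergence in distribution as \<open>\<eta> \<rightarrow> 0\<close>\<close>

text \<open>The limit variable may live on a different probability space. The library notion
  \<^const>\<open>weak_conv_m\<close> is for sequences, so the limit \<open>\<eta> \<rightarrow> 0\<close> with \<open>\<eta> > 0\<close> is taken along all
  sequences.\<close>

definition conv_in_distr_0 ::
    "'w measure \<Rightarrow> (real \<Rightarrow> 'w \<Rightarrow> real) \<Rightarrow> 'v measure \<Rightarrow> ('v \<Rightarrow> real) \<Rightarrow> bool" where
  "conv_in_distr_0 P X Q Y \<longleftrightarrow>
     (\<forall>e :: nat \<Rightarrow> real. (\<forall>k. e k > 0) \<and> e \<longlonglongrightarrow> 0 \<longrightarrow>
        weak_conv_m (\<lambda>k. distr P borel (X (e k))) (distr Q borel Y))"

end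

theory Submission
  imports Defs
begin

text \<open>The theorem is first-order perturbation theory for eigenvalues, with an error that is
  quadratic in the perturbation, followed by a Slutsky argument. Let \<open>T\<close> be the perturbed
  operator with \<open>T u' = l' u'\<close>, let \<open>A u = l u\<close> and \<open>A v = m v\<close>, and put \<open>\<delta> = u' - u\<close>. Moving the
  self-adjoint operators onto \<open>v\<close> and substituting the eigenvalue equations gives

    \<open>(v, (T - A) u) = (l' - l) (v, u) + (l - m) (v, \<delta>) + (l' - l) (v, \<delta>) - ((T - A) v, \<delta>)\<close>

  (lemma \<open>L2_eigen_perturbation\<close>). In the last two terms two small quantities are multiplied, so by
  the Cauchy-Schwarz and arithmetic-geometric mean inequalities they are at most
  \<open>\<parallel>v\<parallel> (\<bar>l' - l\<bar>\<^sup>2 + \<parallel>\<delta>\<parallel>\<^sup>2 + \<parallel>T - A\<parallel>\<^sup>2)\<close> (lemma \<open>L2_eigen_perturbation_remainder\<close>). The moment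
  hypotheses bound the expectation of this by a multiple of \<open>\<eta>\<^sup>2\<close>; after division by \<open>\<eta>\<close> it tends
  to \<open>0\<close> in \<open>L\<^sup>1\<close>, and such an error does not change a limit in distribution
  (lemma \<open>conv_in_distr_0_scale_perturb\<close>).

  With \<open>v = u\<close> the main part of the identity is \<open>l' - l\<close>, which gives the limit of the
  eigenvalues. If \<open>m \<noteq> l\<close>, then \<open>u\<close> and \<open>v\<close> are orthogonal and the main part is \<open>(l - m) (v, \<delta>)\<close>,
  which gives the limit of the eigenvectors. The driving term \<open>(v, (T - A) u) / \<eta>\<close> converges by
  hypothesis when \<open>v\<close> is smooth, whereas an eigenvector is only almost everywhere equal to a smooth
  function; lemma \<open>kernel_integral_cong\<close> shows that the limit does not depend on this choice.\<close>

section \<open>The space of square-integrable functions\<close>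

lemma L2_integrable_mult:
  assumes "f \<in> L2 D" "g \<in> L2 D"
  shows "integrable (lebesgue_on D) (\<lambda>x. f x * g x)"
proof (rule Bochner_Integration.integrable_bound)
  show "integrable (lebesgue_on D) (\<lambda>x. (f x)\<^sup>2 + (g x)\<^sup>2)"
    using assms by (auto simp: L2_def)
  show "(\<lambda>x. f x * g x) \<in> borel_measurable (lebesgue_on D)"
    using assms by (auto simp: L2_def)
  have "\<bar>a * b\<bar> \<le> a\<^sup>2 + b\<^sup>2" for a b :: real
    using sum_squares_bound[of "\<bar>a\<bar>" "\<bar>b\<bar>"] abs_ge_zero[of "a * b"]
    unfolding abs_mult power2_abs by linarith
  then show "AE x in lebesgue_on D. norm (f x * g x) \<le> norm ((f x)\<^sup>2 + (g x)\<^sup>2)"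
    by (intro AE_I2) (metis real_norm_def abs_of_nonneg sum_power2_ge_zero)
qed

lemma L2_lincomb:
  assumes "f \<in> L2 D" "g \<in> L2 D"
  shows "(\<lambda>x. a * f x + b * g x) \<in> L2 D"
proof -
  have "integrable (lebesgue_on D) (\<lambda>x. a\<^sup>2 * (f x)\<^sup>2 + 2 * a * b * (f x * g x) + b\<^sup>2 * (g x)\<^sup>2)"
    using assms L2_integrable_mult[OF assms] by (auto simp: L2_def)
  moreover have "(\<lambda>x. a\<^sup>2 * (f x)\<^sup>2 + 2 * a * b * (f x * g x) + b\<^sup>2 * (g x)\<^sup>2)
      = (\<lambda>x. (a * f x + b * g x)\<^sup>2)"
    by (auto simp: power2_eq_square algebra_simps)
  ultimately show ?thesis
    using assms by (auto simp: L2_def)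
qed

lemma L2_scale: "f \<in> L2 D \<Longrightarrow> (\<lambda>x. c * f x) \<in> L2 D"
  using L2_lincomb[of f D f c 0] by simp

lemma L2_diff: "f \<in> L2 D \<Longrightarrow> g \<in> L2 D \<Longrightarrow> (\<lambda>x. f x - g x) \<in> L2 D"
  using L2_lincomb[of f D g 1 "-1"] by simp

lemma L2_inner_commute: "L2_inner D f g = L2_inner D g f"
  by (simp add: L2_inner_def mult.commute)

lemma L2_inner_lincomb:
  assumes "h \<in> L2 D" "f \<in> L2 D" "g \<in> L2 D"
  shows "L2_inner D h (\<lambda>x. a * f x + b * g x) = a * L2_inner D h f + b * L2_inner D h g"
proof -
  have "L2_inner D h (\<lambda>x. a * f x + b * g x)
      = (LINT x|lebesgue_on D. a * (h x * f x) + b * (h x * g x))"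
    unfolding L2_inner_def by (intro Bochner_Integration.integral_cong) (auto simp: algebra_simps)
  also have "\<dots> = a * L2_inner D h f + b * L2_inner D h g"
    using L2_integrable_mult[OF assms(1,2)] L2_integrable_mult[OF assms(1,3)]
    by (simp add: L2_inner_def)
  finally show ?thesis .
qed

lemma L2_inner_scale:
  "h \<in> L2 D \<Longrightarrow> f \<in> L2 D \<Longrightarrow> L2_inner D h (\<lambda>x. c * f x) = c * L2_inner D h f"
  using L2_inner_lincomb[of h D f f c 0] by simp

lemma L2_inner_diff:
  "h \<in> L2 D \<Longrightarrow> f \<in> L2 D \<Longrightarrow> g \<in> L2 D \<Longrightarrow>
    L2_inner D h (\<lambda>x. f x - g x) = L2_inner D h f - L2_inner D h g"
  using L2_inner_lincomb[of h D f g 1 "-1"] by simp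

lemma L2_inner_cong:
  assumes "f \<in> L2 D" "f' \<in> L2 D" "g \<in> L2 D" "L2_eq D f f'"
  shows "L2_inner D g f = L2_inner D g f'"
  unfolding L2_inner_def using assms
  by (intro integral_cong_AE) (auto simp: L2_def L2_eq_def)

lemma L2_inner_self_nonneg: "0 \<le> L2_inner D f f"
  unfolding L2_inner_def by (rule Bochner_Integration.integral_nonneg) auto

lemma L2_norm_nonneg: "0 \<le> L2_norm D f"
  by (simp add: L2_norm_def L2_inner_self_nonneg)

lemma L2_norm_square: "(L2_norm D f)\<^sup>2 = L2_inner D f f"
  by (simp add: L2_norm_def L2_inner_self_nonneg)

lemma L2_norm_cong:
  assumes "f \<in> L2 D" "f' \<in> L2 D" "L2_eq D f f'"
  shows "L2_norm D f = L2_norm D f'"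
  using L2_inner_cong[OF assms(1,2) assms(1) assms(3)] L2_inner_cong[OF assms(1,2) assms(2) assms(3)]
  unfolding L2_norm_def by (metis L2_inner_commute)

lemma L2_norm_scale: "f \<in> L2 D \<Longrightarrow> L2_norm D (\<lambda>x. c * f x) = \<bar>c\<bar> * L2_norm D f"
proof -
  assume f: "f \<in> L2 D"
  have "L2_inner D (\<lambda>x. c * f x) (\<lambda>x. c * f x) = c\<^sup>2 * L2_inner D f f"
    using L2_inner_scale[OF L2_scale[OF f] f, of c c] L2_inner_scale[OF f f, of c]
    by (simp add: L2_inner_commute[of D "\<lambda>x. c * f x" f] power2_eq_square)
  then show ?thesis
    by (simp add: L2_norm_def real_sqrt_mult)
qed

lemma L2_norm_square_lincomb:
  assumes "f \<in> L2 D" "g \<in> L2 D"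
  shows "(L2_norm D (\<lambda>x. a * f x + b * g x))\<^sup>2
    = a\<^sup>2 * (L2_norm D f)\<^sup>2 + 2 * a * b * L2_inner D f g + b\<^sup>2 * (L2_norm D g)\<^sup>2"
proof -
  let ?h = "\<lambda>x. a * f x + b * g x"
  have "L2_inner D ?h ?h = a * L2_inner D f ?h + b * L2_inner D g ?h"
    using L2_inner_lincomb[OF L2_lincomb[OF assms] assms]
    by (simp only: L2_inner_commute[of D f ?h] L2_inner_commute[of D g ?h])
  also have "\<dots> = a * (a * L2_inner D f f + b * L2_inner D f g)
      + b * (a * L2_inner D f g + b * L2_inner D g g)"
    by (simp only: L2_inner_lincomb assms L2_inner_commute[of D g f])
  also have "\<dots> = a\<^sup>2 * L2_inner D f f + 2 * a * b * L2_inner D f g + b\<^sup>2 * L2_inner D g g"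
    by (simp add: power2_eq_square algebra_simps)
  finally show ?thesis
    by (simp only: L2_norm_square)
qed

text \<open>The quadratic form \<open>\<parallel>a f + b g\<parallel>\<^sup>2\<close> in \<open>(a, b)\<close> is nonnegative, hence its discriminant is not
  positive. If \<open>\<parallel>g\<parallel> = 0\<close> the form is affine in \<open>b\<close>, so its slope must vanish.\<close>

lemma L2_Cauchy_Schwarz:
  assumes "f \<in> L2 D" "g \<in> L2 D"
  shows "\<bar>L2_inner D f g\<bar> \<le> L2_norm D f * L2_norm D g"
proof -
  let ?p = "(L2_norm D f)\<^sup>2" and ?q = "(L2_norm D g)\<^sup>2" and ?r = "L2_inner D f g"
  have quad: "0 \<le> a\<^sup>2 * ?p + 2 * a * b * ?r + b\<^sup>2 * ?q" for a b
    unfolding L2_norm_square_lincomb[OF assms, symmetric] by simp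
  have "?r\<^sup>2 \<le> ?p * ?q"
  proof (cases "?q = 0")
    case True
    have "?r = 0"
    proof (rule ccontr)
      assume "?r \<noteq> 0"
      \<comment> \<open>chosen so that the form takes the value \<open>-1\<close> at \<open>(1, ?b)\<close>\<close>
      let ?b = "- (?p + 1) / (2 * ?r)"
      have "0 \<le> ?p + 2 * ?b * ?r"
        using quad[of 1 ?b] True by simp
      also have "2 * ?b * ?r = - ?p - 1"
        using \<open>?r \<noteq> 0\<close> by (simp add: field_simps)
      finally show False
        by simp
    qed
    then show ?thesis by simp
  next
    case False
    then have "?q > 0" by simp
    \<comment> \<open>the form at its minimiser \<open>(1, - ?r / ?q)\<close>, multiplied by \<open>?q\<^sup>2\<close>\<close>
    have "0 \<le> ?q\<^sup>2 * ?p + 2 * ?q * (- ?r) * ?r + (- ?r)\<^sup>2 * ?q"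
      by (rule quad)
    also have "\<dots> = ?q * (?p * ?q - ?r\<^sup>2)"
      by (simp add: power2_eq_square algebra_simps)
    finally show ?thesis
      using \<open>?q > 0\<close> by (simp add: zero_le_mult_iff)
  qed
  then have "\<bar>?r\<bar>\<^sup>2 \<le> (L2_norm D f * L2_norm D g)\<^sup>2"
    by (simp add: power_mult_distrib)
  then show ?thesis
    by (rule power2_le_imp_le) (simp add: L2_norm_nonneg)
qed

lemma L2_norm_diff_le:
  assumes "f \<in> L2 D" "g \<in> L2 D"
  shows "L2_norm D (\<lambda>x. f x - g x) \<le> L2_norm D f + L2_norm D g"
proof (rule power2_le_imp_le)
  have "(L2_norm D (\<lambda>x. f x - g x))\<^sup>2
      = (L2_norm D f)\<^sup>2 - 2 * L2_inner D f g + (L2_norm D g)\<^sup>2"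
    using L2_norm_square_lincomb[OF assms, of 1 "-1"] by simp
  also have "\<dots> \<le> (L2_norm D f + L2_norm D g)\<^sup>2"
    using L2_Cauchy_Schwarz[OF assms] by (simp add: power2_sum abs_le_iff)
  finally show "(L2_norm D (\<lambda>x. f x - g x))\<^sup>2 \<le> (L2_norm D f + L2_norm D g)\<^sup>2" .
qed (simp add: L2_norm_nonneg)

section \<open>The operator norm\<close>

lemma L2_bounded_linear_mem: "L2_bounded_linear D T \<Longrightarrow> f \<in> L2 D \<Longrightarrow> T f \<in> L2 D"
  by (simp add: L2_bounded_linear_def)

lemma L2_bounded_linear_bound:
  "L2_bounded_linear D T \<Longrightarrow> \<exists>C. \<forall>f\<in>L2 D. L2_norm D (T f) \<le> C * L2_norm D f"
  by (simp add: L2_bounded_linear_def)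

lemma L2_bounded_linear_diff:
  assumes T: "L2_bounded_linear D T" and S: "L2_bounded_linear D S"
  shows "L2_bounded_linear D (\<lambda>f x. T f x - S f x)"
  unfolding L2_bounded_linear_def
proof (intro conjI ballI allI)
  note mem = L2_bounded_linear_mem[OF T] L2_bounded_linear_mem[OF S]
  show "(\<lambda>x. T f x - S f x) \<in> L2 D" if "f \<in> L2 D" for f
    using that by (simp add: L2_diff mem)
  show "L2_eq D (\<lambda>x. T (\<lambda>x. a * f x + b * g x) x - S (\<lambda>x. a * f x + b * g x) x)
          (\<lambda>x. a * (T f x - S f x) + b * (T g x - S g x))"
    if "f \<in> L2 D" "g \<in> L2 D" for f g a b
  proof -
    have "L2_eq D (T (\<lambda>x. a * f x + b * g x)) (\<lambda>x. a * T f x + b * T g x)"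
         "L2_eq D (S (\<lambda>x. a * f x + b * g x)) (\<lambda>x. a * S f x + b * S g x)"
      using T S that by (auto simp: L2_bounded_linear_def)
    then show ?thesis
      unfolding L2_eq_def by eventually_elim (simp add: algebra_simps)
  qed
  obtain C C' where C: "\<And>f. f \<in> L2 D \<Longrightarrow> L2_norm D (T f) \<le> C * L2_norm D f"
    and C': "\<And>f. f \<in> L2 D \<Longrightarrow> L2_norm D (S f) \<le> C' * L2_norm D f"
    using L2_bounded_linear_bound[OF T] L2_bounded_linear_bound[OF S] by blast
  have "L2_norm D (\<lambda>x. T f x - S f x) \<le> (C + C') * L2_norm D f" if "f \<in> L2 D" for f
    using L2_norm_diff_le[OF mem[OF that]] C[OF that] C'[OF that] by (simp add: algebra_simps)
  then show "\<exists>C. \<forall>f\<in>L2 D. L2_norm D (\<lambda>x. T f x - S f x) \<le> C * L2_norm D f"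
    by blast
qed

text \<open>Normalise \<open>f\<close> to reach the unit ball. Two degenerate situations are covered by the bound on
  \<open>T\<close>: it makes the supremum in \<^const>\<open>L2_opnorm\<close> one of a bounded set, and it forces
  \<open>\<parallel>T f\<parallel> = 0\<close> when \<open>\<parallel>f\<parallel> = 0\<close>.\<close>

lemma L2_norm_le_opnorm:
  assumes T: "L2_bounded_linear D T" and f: "f \<in> L2 D"
  shows "L2_norm D (T f) \<le> L2_opnorm D T * L2_norm D f"
proof -
  obtain C where C: "\<And>f. f \<in> L2 D \<Longrightarrow> L2_norm D (T f) \<le> C * L2_norm D f"
    using L2_bounded_linear_bound[OF T] by blast
  show ?thesis
  proof (cases "L2_norm D f = 0")
    case True
    then show ?thesis using C[OF f] by simp
  next
    case False
    then have pos: "L2_norm D f > 0"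
      using L2_norm_nonneg[of D f] by linarith
    let ?c = "1 / L2_norm D f"
    let ?g = "\<lambda>x. ?c * f x"
    have g: "?g \<in> L2 D" "L2_norm D ?g \<le> 1"
      using L2_scale[OF f, of ?c] L2_norm_scale[OF f, of ?c] pos by simp_all
    have "bdd_above ((\<lambda>f. L2_norm D (T f)) ` {f \<in> L2 D. L2_norm D f \<le> 1})"
    proof (rule bdd_aboveI2)
      fix h assume h: "h \<in> {f \<in> L2 D. L2_norm D f \<le> 1}"
      have "L2_norm D (T h) \<le> C * L2_norm D h"
        using h C by simp
      also have "\<dots> \<le> \<bar>C\<bar> * 1"
        using h by (intro mult_mono) (auto simp: L2_norm_nonneg)
      finally show "L2_norm D (T h) \<le> \<bar>C\<bar>" by simp
    qed
    then have "L2_norm D (T ?g) \<le> L2_opnorm D T"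
      unfolding L2_opnorm_def using g by (intro cSUP_upper) auto
    moreover have "L2_norm D (T ?g) = ?c * L2_norm D (T f)"
    proof -
      have "L2_eq D (T (\<lambda>x. ?c * f x + 0 * f x)) (\<lambda>x. ?c * T f x + 0 * T f x)"
        using T f unfolding L2_bounded_linear_def by blast
      then have "L2_eq D (T ?g) (\<lambda>x. ?c * T f x)"
        by simp
      then have "L2_norm D (T ?g) = L2_norm D (\<lambda>x. ?c * T f x)"
        by (rule L2_norm_cong[OF L2_bounded_linear_mem[OF T g(1)]
              L2_scale[OF L2_bounded_linear_mem[OF T f]]])
      also have "\<dots> = ?c * L2_norm D (T f)"
        using pos L2_norm_scale[OF L2_bounded_linear_mem[OF T f], of ?c] by simp
      finally show ?thesis .
    qed
    ultimately have "?c * L2_norm D (T f) \<le> L2_opnorm D T"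
      by (simp only:)
    then show ?thesis
      using pos by (simp add: field_simps)
  qed
qed

section \<open>First-order perturbation of an eigenvector\<close>

lemma L2_eigen_inner:
  assumes "L2_bounded_linear D T" "L2_eigen D T l u" "v \<in> L2 D"
  shows "L2_inner D v (T u) = l * L2_inner D v u"
proof -
  have u: "u \<in> L2 D" "L2_eq D (T u) (\<lambda>x. l * u x)"
    using assms(2) by (auto simp: L2_eigen_def)
  show ?thesis
    using L2_inner_cong[OF L2_bounded_linear_mem[OF assms(1) u(1)] L2_scale[OF u(1)] assms(3) u(2)]
    by (simp add: L2_inner_scale assms(3) u(1))
qed

lemma L2_eigen_orthogonal:
  assumes "L2_bounded_linear D T" "L2_self_adjoint D T"
    and "L2_eigen D T l u" "L2_eigen D T m v" "m \<noteq> l"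
  shows "L2_inner D v u = 0"
proof -
  have uv: "u \<in> L2 D" "v \<in> L2 D"
    using assms by (auto simp: L2_eigen_def)
  have "l * L2_inner D v u = L2_inner D (T v) u"
    using L2_eigen_inner[OF assms(1,3) uv(2)] assms(2) uv by (simp add: L2_self_adjoint_def)
  also have "\<dots> = m * L2_inner D v u"
    using L2_eigen_inner[OF assms(1,4) uv(1)] by (simp add: L2_inner_commute)
  finally show ?thesis
    using assms(5) by simp
qed

text \<open>By self-adjointness \<open>(v, T u) = (T v, u') - (T v, \<delta>) = l' (v, u') - (T v, \<delta>)\<close> with
  \<open>\<delta> = u' - u\<close>; subtracting \<open>(v, S u) = l (v, u)\<close> and using \<open>(S v, \<delta>) = m (v, \<delta>)\<close> leaves the
  identity. The last bracket is of second order.\<close>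

lemma L2_eigen_perturbation:
  assumes T: "L2_bounded_linear D T" "L2_self_adjoint D T"
    and S: "L2_bounded_linear D S" "L2_self_adjoint D S"
    and u: "L2_eigen D S l u" and u': "L2_eigen D T l' u'" and v: "L2_eigen D S m v"
  shows "L2_inner D v (\<lambda>x. T u x - S u x)
    = (l' - l) * L2_inner D v u + (l - m) * L2_inner D v (\<lambda>x. u' x - u x)
      + ((l' - l) * L2_inner D v (\<lambda>x. u' x - u x)
         - L2_inner D (\<lambda>x. T v x - S v x) (\<lambda>x. u' x - u x))"
proof -
  have mem: "u \<in> L2 D" "u' \<in> L2 D" "v \<in> L2 D"
    using u u' v by (auto simp: L2_eigen_def)
  note memT = L2_bounded_linear_mem[OF T(1)] and memS = L2_bounded_linear_mem[OF S(1)]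
  let ?d = "\<lambda>x. u' x - u x"
  have d: "?d \<in> L2 D" using mem by (simp add: L2_diff)
  have Tu: "L2_inner D v (T u) = l' * L2_inner D v u' - L2_inner D (T v) ?d"
  proof -
    have "L2_inner D v (T u) = L2_inner D (T v) u"
      using T(2) mem by (simp add: L2_self_adjoint_def)
    also have "\<dots> = L2_inner D (T v) u' - L2_inner D (T v) ?d"
      using mem memT by (simp add: L2_inner_diff)
    also have "L2_inner D (T v) u' = L2_inner D v (T u')"
      using T(2) mem by (simp add: L2_self_adjoint_def)
    finally show ?thesis
      using L2_eigen_inner[OF T(1) u' mem(3)] by simp
  qed
  have Sd: "L2_inner D (S v) ?d = m * L2_inner D v ?d"
    using L2_eigen_inner[OF S(1) v d] by (simp add: L2_inner_commute)
  have "L2_inner D (\<lambda>x. T v x - S v x) ?d = L2_inner D (T v) ?d - L2_inner D (S v) ?d"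
    using L2_inner_diff[OF d memT[OF mem(3)] memS[OF mem(3)]] by (simp add: L2_inner_commute)
  then show ?thesis
    using Tu Sd L2_eigen_inner[OF S(1) u mem(3)] mem memT memS
    by (simp add: L2_inner_diff algebra_simps)
qed

text \<open>The products of small quantities are replaced by sums of squares, because second moments of
  the three quantities are what the hypotheses of the theorem control.\<close>

lemma L2_eigen_perturbation_remainder:
  assumes T: "L2_bounded_linear D T" "L2_self_adjoint D T"
    and S: "L2_bounded_linear D S" "L2_self_adjoint D S"
    and u: "L2_eigen D S l u" and u': "L2_eigen D T l' u'" and v: "L2_eigen D S m v"
  shows "\<bar>(l' - l) * L2_inner D v u + (l - m) * L2_inner D v (\<lambda>x. u' x - u x)
           - L2_inner D v (\<lambda>x. T u x - S u x)\<bar>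
    \<le> L2_norm D v * (\<bar>l - l'\<bar>\<^sup>2 + (L2_norm D (\<lambda>x. u' x - u x))\<^sup>2
         + (L2_opnorm D (\<lambda>f x. T f x - S f x))\<^sup>2)"
proof -
  have mem: "u \<in> L2 D" "u' \<in> L2 D" "v \<in> L2 D"
    using u u' v by (auto simp: L2_eigen_def)
  let ?d = "\<lambda>x. u' x - u x" and ?w = "\<lambda>x. T v x - S v x"
  let ?o = "L2_opnorm D (\<lambda>f x. T f x - S f x)"
  have d: "?d \<in> L2 D" and w: "?w \<in> L2 D"
    using mem L2_bounded_linear_mem[OF T(1)] L2_bounded_linear_mem[OF S(1)]
    by (simp_all add: L2_diff)
  have TS: "L2_norm D ?w \<le> ?o * L2_norm D v"
    using L2_norm_le_opnorm[OF L2_bounded_linear_diff[OF T(1) S(1)] mem(3)] .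
  have amgm: "a * b \<le> (a\<^sup>2 + b\<^sup>2) / 2" for a b :: real
    using sum_squares_bound[of a b] by simp
  have "\<bar>(l' - l) * L2_inner D v ?d\<bar> \<le> \<bar>l - l'\<bar> * (L2_norm D v * L2_norm D ?d)"
    unfolding abs_mult abs_minus_commute[of l' l]
    by (rule mult_left_mono[OF L2_Cauchy_Schwarz[OF mem(3) d] abs_ge_zero])
  also have "\<dots> \<le> L2_norm D v * ((\<bar>l - l'\<bar>\<^sup>2 + (L2_norm D ?d)\<^sup>2) / 2)"
    using mult_left_mono[OF amgm[of "\<bar>l - l'\<bar>" "L2_norm D ?d"] L2_norm_nonneg[of D v]]
    by (simp only: mult_ac)
  finally have 1: "\<bar>(l' - l) * L2_inner D v ?d\<bar>
      \<le> L2_norm D v * ((\<bar>l - l'\<bar>\<^sup>2 + (L2_norm D ?d)\<^sup>2) / 2)" .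
  have "\<bar>L2_inner D ?w ?d\<bar> \<le> L2_norm D ?w * L2_norm D ?d"
    by (rule L2_Cauchy_Schwarz[OF w d])
  also have "\<dots> \<le> ?o * L2_norm D v * L2_norm D ?d"
    by (rule mult_right_mono[OF TS L2_norm_nonneg])
  also have "\<dots> \<le> L2_norm D v * ((?o\<^sup>2 + (L2_norm D ?d)\<^sup>2) / 2)"
    using mult_left_mono[OF amgm[of ?o "L2_norm D ?d"] L2_norm_nonneg[of D v]]
    by (simp only: mult_ac)
  finally have 2: "\<bar>L2_inner D ?w ?d\<bar> \<le> L2_norm D v * ((?o\<^sup>2 + (L2_norm D ?d)\<^sup>2) / 2)" .
  have "L2_norm D v * ((\<bar>l - l'\<bar>\<^sup>2 + (L2_norm D ?d)\<^sup>2) / 2)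
        + L2_norm D v * ((?o\<^sup>2 + (L2_norm D ?d)\<^sup>2) / 2)
      \<le> L2_norm D v * (\<bar>l - l'\<bar>\<^sup>2 + (L2_norm D ?d)\<^sup>2 + ?o\<^sup>2)"
    unfolding distrib_left[symmetric] by (intro mult_left_mono L2_norm_nonneg) (simp add: field_simps)
  moreover have "\<bar>(l' - l) * L2_inner D v u + (l - m) * L2_inner D v ?d
           - L2_inner D v (\<lambda>x. T u x - S u x)\<bar>
      \<le> \<bar>(l' - l) * L2_inner D v ?d\<bar> + \<bar>L2_inner D ?w ?d\<bar>"
    unfolding L2_eigen_perturbation[OF assms] by linarith
  ultimately show ?thesis
    using 1 2 by linarith
qed

section \<open>Convergence in distribution\<close>

lemma cts_step_Lipschitz:
  assumes "a < b"
  shows "\<bar>cts_step a b x - cts_step a b y\<bar> \<le> \<bar>x - y\<bar> / (b - a)"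
proof -
  have "cts_step a b z = max 0 (min 1 ((b - z) / (b - a)))" for z
    using assms by (auto simp: cts_step_def max_def min_def divide_simps)
  moreover have "\<bar>max 0 (min 1 p) - max 0 (min 1 q)\<bar> \<le> \<bar>p - q\<bar>" for p q :: real
    by (auto simp: max_def min_def)
  moreover have "\<bar>(b - x) / (b - a) - (b - y) / (b - a)\<bar> = \<bar>x - y\<bar> / (b - a)"
    using assms by (simp add: diff_divide_distrib[symmetric] abs_minus_commute)
  ultimately show ?thesis
    by metis
qed

lemma isCont_cts_step: "a < b \<Longrightarrow> isCont (cts_step a b) x"
  by (rule continuous_on_interior[OF uniformly_continuous_imp_continuous[OF
        cts_step_uniformly_continuous]]) auto

text \<open>Slutsky's theorem with an error that tends to \<open>0\<close> in \<open>L\<^sup>1\<close>. It suffices to test weak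
  convergence against the ramps \<^const>\<open>cts_step\<close>. These are Lipschitz, so the error changes their
  expectation by at most a constant times \<open>\<integral> G k\<close>, and continuous, so
  the scaling by \<open>c\<close> can be absorbed in the test function.\<close>

lemma weak_conv_scale_perturb:
  fixes X Y G :: "nat \<Rightarrow> 'w \<Rightarrow> real" and Z :: "'v \<Rightarrow> real" and c :: real
  assumes P: "prob_space P" and Q: "prob_space Q"
    and X[measurable]: "\<And>k. X k \<in> borel_measurable P"
    and Y[measurable]: "\<And>k. Y k \<in> borel_measurable P"
    and Z[measurable]: "Z \<in> borel_measurable Q"
    and conv: "weak_conv_m (\<lambda>k. distr P borel (X k)) (distr Q borel Z)"
    and G: "\<And>k. integrable P (G k)" "(\<lambda>k. LINT \<omega>|P. G k \<omega>) \<longlonglongrightarrow> 0"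
    and close: "\<And>k \<omega>. \<omega> \<in> space P \<Longrightarrow> \<bar>Y k \<omega> - c * X k \<omega>\<bar> \<le> G k \<omega>"
  shows "weak_conv_m (\<lambda>k. distr P borel (Y k)) (distr Q borel (\<lambda>v. c * Z v))"
proof (rule integral_cts_step_conv_imp_weak_conv)
  interpret P: prob_space P by (rule P)
  interpret Q: prob_space Q by (rule Q)
  show "real_distribution (distr P borel (Y k))" for k
    by simp
  show "real_distribution (distr Q borel (\<lambda>v. c * Z v))"
    by simp
  fix a b :: real assume ab: "a < b"
  let ?\<phi> = "cts_step a b"
  have [measurable]: "?\<phi> \<in> borel_measurable borel"
    using isCont_cts_step[OF ab]
    by (intro borel_measurable_continuous_onI continuous_at_imp_continuous_on) auto
  have bd: "\<bar>?\<phi> x\<bar> \<le> 1" for x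
    using ab by (auto simp: cts_step_def)
  have "(\<lambda>k. integral\<^sup>L (distr P borel (X k)) (\<lambda>x. ?\<phi> (c * x)))
      \<longlonglongrightarrow> integral\<^sup>L (distr Q borel Z) (\<lambda>x. ?\<phi> (c * x))"
  proof (rule weak_conv_imp_integral_bdd_continuous_conv[OF _ _ conv])
    show "isCont (\<lambda>x. ?\<phi> (c * x)) x" for x
      by (rule isCont_o2[of _ "\<lambda>x. c * x"]) (auto intro!: continuous_intros isCont_cts_step ab)
    show "norm (?\<phi> (c * x)) \<le> 1" for x
      using bd by simp
  qed auto
  then have lim: "(\<lambda>k. LINT \<omega>|P. ?\<phi> (c * X k \<omega>)) \<longlonglongrightarrow> (LINT v|Q. ?\<phi> (c * Z v))"
    by (simp add: integral_distr)
  have diff: "(\<lambda>k. (LINT \<omega>|P. ?\<phi> (Y k \<omega>)) - (LINT \<omega>|P. ?\<phi> (c * X k \<omega>))) \<longlonglongrightarrow> 0"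
  proof (rule Lim_null_comparison)
    show "(\<lambda>k. (LINT \<omega>|P. G k \<omega>) / (b - a)) \<longlonglongrightarrow> 0"
      using tendsto_divide[OF G(2) tendsto_const[of "b - a"]] ab by simp
    show "\<forall>\<^sub>F k in sequentially.
        norm ((LINT \<omega>|P. ?\<phi> (Y k \<omega>)) - (LINT \<omega>|P. ?\<phi> (c * X k \<omega>))) \<le> (LINT \<omega>|P. G k \<omega>) / (b - a)"
    proof (intro always_eventually allI)
      fix k
      have int: "integrable P (\<lambda>\<omega>. ?\<phi> (Y k \<omega>))" "integrable P (\<lambda>\<omega>. ?\<phi> (c * X k \<omega>))"
        using bd by (auto intro!: P.integrable_const_bound[where B=1])
      have "norm ((LINT \<omega>|P. ?\<phi> (Y k \<omega>)) - (LINT \<omega>|P. ?\<phi> (c * X k \<omega>)))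
          = norm (LINT \<omega>|P. ?\<phi> (Y k \<omega>) - ?\<phi> (c * X k \<omega>))"
        using int by simp
      also have "\<dots> \<le> (LINT \<omega>|P. G k \<omega> / (b - a))"
      proof (rule order_trans[OF integral_norm_bound integral_mono])
        fix \<omega> assume "\<omega> \<in> space P"
        have "\<bar>?\<phi> (Y k \<omega>) - ?\<phi> (c * X k \<omega>)\<bar> \<le> \<bar>Y k \<omega> - c * X k \<omega>\<bar> / (b - a)"
          by (rule cts_step_Lipschitz[OF ab])
        also have "\<dots> \<le> G k \<omega> / (b - a)"
          using close[OF \<open>\<omega> \<in> space P\<close>] ab by (intro divide_right_mono) auto
        finally show "norm (?\<phi> (Y k \<omega>) - ?\<phi> (c * X k \<omega>)) \<le> G k \<omega> / (b - a)"
          by simp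
      qed (use int G(1) in auto)
      finally show "norm ((LINT \<omega>|P. ?\<phi> (Y k \<omega>)) - (LINT \<omega>|P. ?\<phi> (c * X k \<omega>)))
          \<le> (LINT \<omega>|P. G k \<omega>) / (b - a)"
        by simp
    qed
  qed
  show "(\<lambda>k. integral\<^sup>L (distr P borel (Y k)) ?\<phi>) \<longlonglongrightarrow> integral\<^sup>L (distr Q borel (\<lambda>v. c * Z v)) ?\<phi>"
    using tendsto_add[OF diff lim] by (simp add: integral_distr)
qed

text \<open>The form in which the perturbation estimate is used: the error appears multiplied by \<open>\<eta>\<close>, and
  its bound \<open>G \<eta>\<close> has expectation of order \<open>\<eta>\<^sup>2\<close>.\<close>

lemma conv_in_distr_0_scale_perturb:
  fixes X Y G :: "real \<Rightarrow> 'w \<Rightarrow> real" and Z :: "'v \<Rightarrow> real" and c :: real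
  assumes P: "prob_space P" and Q: "prob_space Q"
    and X: "\<And>\<eta>. \<eta> > 0 \<Longrightarrow> X \<eta> \<in> borel_measurable P"
    and Y: "\<And>\<eta>. \<eta> > 0 \<Longrightarrow> Y \<eta> \<in> borel_measurable P"
    and Z: "Z \<in> borel_measurable Q"
    and conv: "conv_in_distr_0 P X Q Z"
    and G: "\<And>\<eta>. \<eta> > 0 \<Longrightarrow> integrable P (G \<eta>)"
      "\<And>\<eta>. \<eta> > 0 \<Longrightarrow> (LINT \<omega>|P. G \<eta> \<omega>) \<le> K * \<eta>\<^sup>2"
    and close: "\<And>\<eta> \<omega>. \<eta> > 0 \<Longrightarrow> \<omega> \<in> space P \<Longrightarrow> \<eta> * \<bar>Y \<eta> \<omega> - c * X \<eta> \<omega>\<bar> \<le> G \<eta> \<omega>"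
  shows "conv_in_distr_0 P Y Q (\<lambda>v. c * Z v)"
  unfolding conv_in_distr_0_def
proof (intro allI impI)
  fix e :: "nat \<Rightarrow> real" assume e: "(\<forall>k. e k > 0) \<and> e \<longlonglongrightarrow> 0"
  then have pos: "e k > 0" for k by simp
  let ?G = "\<lambda>k \<omega>. G (e k) \<omega> / e k"
  have close': "\<bar>Y (e k) \<omega> - c * X (e k) \<omega>\<bar> \<le> ?G k \<omega>" if "\<omega> \<in> space P" for k \<omega>
    using close[OF pos[of k] that] pos[of k] by (simp add: field_simps)
  show "weak_conv_m (\<lambda>k. distr P borel (Y (e k))) (distr Q borel (\<lambda>v. c * Z v))"
  proof (rule weak_conv_scale_perturb[OF P Q X[OF pos] Y[OF pos] Z _ _ _ close'])
    show "weak_conv_m (\<lambda>k. distr P borel (X (e k))) (distr Q borel Z)"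
      using conv e by (simp add: conv_in_distr_0_def)
    show "integrable P (?G k)" for k
      using G(1)[OF pos] by simp
    show "(\<lambda>k. LINT \<omega>|P. ?G k \<omega>) \<longlonglongrightarrow> 0"
    proof (rule tendsto_sandwich[OF _ _ tendsto_const])
      show "(\<lambda>k. K * e k) \<longlonglongrightarrow> 0"
        using e tendsto_mult_left[of e 0 sequentially K] by simp
      show "\<forall>\<^sub>F k in sequentially. (LINT \<omega>|P. ?G k \<omega>) \<le> K * e k"
      proof (intro always_eventually allI)
        fix k
        show "(LINT \<omega>|P. ?G k \<omega>) \<le> K * e k"
          using G(2)[OF pos[of k]] pos[of k] by (simp add: field_simps power2_eq_square)
      qed
      show "\<forall>\<^sub>F k in sequentially. 0 \<le> (LINT \<omega>|P. ?G k \<omega>)"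
        by (intro always_eventually allI Bochner_Integration.integral_nonneg
              order_trans[OF abs_ge_zero close'])
    qed
  qed auto
qed

section \<open>Independence of representatives\<close>

lemma complete_measure_lebesgue_on:
  assumes D: "D \<in> sets lebesgue"
  shows "complete_measure (lebesgue_on D)"
proof
  fix A B assume "A \<subseteq> B" "B \<in> null_sets (lebesgue_on D)"
  then have "A \<in> null_sets lebesgue" "A \<subseteq> D"
    using D completion.complete2[of A B lborel] by (auto simp: null_sets_restrict_space)
  then show "A \<in> sets (lebesgue_on D)"
    using D by (auto simp: sets_restrict_space_iff)
qed

lemma borel_measurable_lebesgue_on_AE_cong:
  fixes f g :: "'a::euclidean_space \<Rightarrow> real"
  assumes D: "D \<in> sets lebesgue" and f: "f \<in> borel_measurable (lebesgue_on D)"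
    and eq: "AE x in lebesgue_on D. f x = g x"
  shows "g \<in> borel_measurable (lebesgue_on D)"
proof (rule borel_measurableI)
  fix S :: "real set" assume S: "open S"
  let ?M = "lebesgue_on D"
  interpret complete_measure ?M
    by (rule complete_measure_lebesgue_on[OF D])
  show "g -` S \<inter> space ?M \<in> sets ?M"
  proof (rule in_sets_AE)
    show "AE x in ?M. x \<in> f -` S \<inter> space ?M \<longleftrightarrow> x \<in> g -` S \<inter> space ?M"
      using eq by eventually_elim simp
    show "f -` S \<inter> space ?M \<in> sets ?M"
      by (rule measurable_sets[OF f borel_open[OF S]])
  qed simp
qed

text \<open>The equality holds at every \<open>y\<close>, not just almost everywhere, so \<^const>\<open>noise_integral\<close>, which
  depends on \<open>W\<close> at this very function, is literally unchanged. The sections of \<open>\<sigma>\<close> may fail to be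
  measurable; since Lebesgue measure is complete, the two products are then both
  non-measurable and both integrals have the default value \<open>0\<close>.\<close>

lemma kernel_integral_cong:
  assumes D: "D \<in> sets lebesgue" and eq: "L2_eq D f g"
  shows "kernel_integral D \<sigma> f = kernel_integral D \<sigma> g"
proof
  fix y
  have ae: "AE x in lebesgue_on D. f x * \<sigma> x y = g x * \<sigma> x y"
    using eq unfolding L2_eq_def by eventually_elim simp
  have ae': "AE x in lebesgue_on D. g x * \<sigma> x y = f x * \<sigma> x y"
    using ae by eventually_elim (rule sym)
  show "kernel_integral D \<sigma> f y = kernel_integral D \<sigma> g y"
  proof (cases "(\<lambda>x. f x * \<sigma> x y) \<in> borel_measurable (lebesgue_on D)")
    case True
    then show ?thesis
      unfolding kernel_integral_def
      by (intro integral_cong_AE borel_measurable_lebesgue_on_AE_cong[OF D True ae] ae)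
  next
    case False
    then have "\<not> integrable (lebesgue_on D) (\<lambda>x. f x * \<sigma> x y)"
      by auto
    moreover have "\<not> integrable (lebesgue_on D) (\<lambda>x. g x * \<sigma> x y)"
      using False borel_measurable_lebesgue_on_AE_cong[OF D _ ae']
      by (auto dest: borel_measurable_integrable)
    ultimately show ?thesis
      by (simp add: kernel_integral_def not_integrable_integral_eq)
  qed
qed

lemma white_noise_measurable:
  assumes "white_noise D Q W" "g \<in> L2 D"
  shows "W g \<in> borel_measurable Q"
proof -
  have "gaussian_rv Q (\<lambda>v. \<Sum>i<(1::nat). (\<lambda>_. 1) i * W ((\<lambda>_. g) i) v)"
    using assms(1)[unfolded white_noise_def, THEN conjunct2, THEN conjunct1, rule_format,
        of 1 "\<lambda>_. g" "\<lambda>_. 1"] assms(2) by simp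
  then show ?thesis
    by (simp add: gaussian_rv_def)
qed

section \<open>Limits of eigenvalues and eigenvectors\<close>

theorem mainTheorem4:
  fixes D :: "'a::euclidean_space set"
    and P :: "'w measure"
    and A\<^sub>\<eta> :: "real \<Rightarrow> 'w \<Rightarrow> ('a \<Rightarrow> real) \<Rightarrow> ('a \<Rightarrow> real)"
    and A :: "('a \<Rightarrow> real) \<Rightarrow> ('a \<Rightarrow> real)"
    and lam :: real and u :: "'a \<Rightarrow> real"
    and lam\<^sub>\<eta> :: "real \<Rightarrow> 'w \<Rightarrow> real"
    and u\<^sub>\<eta> :: "real \<Rightarrow> 'w \<Rightarrow> 'a \<Rightarrow> real"
    and Smooth :: "('a \<Rightarrow> real) set"
    and \<sigma> :: "'a \<Rightarrow> 'a \<Rightarrow> real"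
    and Q :: "'v measure"
    and W :: "('a \<Rightarrow> real) \<Rightarrow> 'v \<Rightarrow> real"
  assumes "open D" and "prob_space P"
    and "L2_compact D A" and "L2_self_adjoint D A"
    and "\<And>\<eta> \<omega>. \<eta> > 0 \<Longrightarrow> \<omega> \<in> space P \<Longrightarrow> L2_compact D (A\<^sub>\<eta> \<eta> \<omega>) \<and> L2_self_adjoint D (A\<^sub>\<eta> \<eta> \<omega>)"
    and "\<And>\<eta>. \<eta> > 0 \<Longrightarrow> L2_random_operator D P (A\<^sub>\<eta> \<eta>)"
    and "\<exists>B. \<forall>\<eta>>0. AE \<omega> in P. L2_opnorm D (A\<^sub>\<eta> \<eta> \<omega>) \<le> B"
    and "\<exists>C. \<forall>\<eta>>0.
           integrable P (\<lambda>\<omega>. (L2_opnorm D (\<lambda>f x. A\<^sub>\<eta> \<eta> \<omega> f x - A f x))\<^sup>2) \<and>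
           (LINT \<omega>|P. (L2_opnorm D (\<lambda>f x. A\<^sub>\<eta> \<eta> \<omega> f x - A f x))\<^sup>2) \<le> C * \<eta>\<^sup>2"
    and "L2_eigen D A lam u" and "L2_norm D u = 1"
    and "\<And>\<eta>. \<eta> > 0 \<Longrightarrow> lam\<^sub>\<eta> \<eta> \<in> borel_measurable P"
    and "\<And>\<eta>. \<eta> > 0 \<Longrightarrow> L2_random_element D P (u\<^sub>\<eta> \<eta>)"
    and "\<And>\<eta> \<omega>. \<eta> > 0 \<Longrightarrow> \<omega> \<in> space P \<Longrightarrow>
           L2_eigen D (A\<^sub>\<eta> \<eta> \<omega>) (lam\<^sub>\<eta> \<eta> \<omega>) (u\<^sub>\<eta> \<eta> \<omega>) \<and> L2_norm D (u\<^sub>\<eta> \<eta> \<omega>) = 1"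
    and "\<exists>C. \<forall>\<eta>>0.
           integrable P (\<lambda>\<omega>. \<bar>lam - lam\<^sub>\<eta> \<eta> \<omega>\<bar>\<^sup>2) \<and>
           integrable P (\<lambda>\<omega>. (L2_norm D (\<lambda>x. u\<^sub>\<eta> \<eta> \<omega> x - u x))\<^sup>2) \<and>
           (LINT \<omega>|P. \<bar>lam - lam\<^sub>\<eta> \<eta> \<omega>\<bar>\<^sup>2) +
             (LINT \<omega>|P. (L2_norm D (\<lambda>x. u\<^sub>\<eta> \<eta> \<omega> x - u x))\<^sup>2) \<le> C * \<eta>\<^sup>2"
    (* Smooth is the class of sufficiently smooth functions, left arbitrary; smoothness of an
       eigenvector concerns a suitable representative *)
    and "white_noise D Q W"
    and "Smooth \<subseteq> L2 D"
    and "\<And>M. M \<in> Smooth \<Longrightarrow> kernel_integrand_ok D \<sigma> M"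
    and "\<And>M. M \<in> Smooth \<Longrightarrow>
           conv_in_distr_0 P (\<lambda>\<eta> \<omega>. L2_inner D M (\<lambda>x. (A\<^sub>\<eta> \<eta> \<omega> u x - A u x) / \<eta>))
             Q (noise_integral D W \<sigma> M)"
    and "\<And>l v. L2_eigen D A l v \<Longrightarrow> \<exists>M\<in>Smooth. L2_eq D v M"
  shows "conv_in_distr_0 P (\<lambda>\<eta> \<omega>. (lam\<^sub>\<eta> \<eta> \<omega> - lam) / \<eta>) Q (noise_integral D W \<sigma> u) \<and>
         (\<forall>lam_m u_m. L2_eigen D A lam_m u_m \<and> lam_m \<noteq> lam \<longrightarrow>
            conv_in_distr_0 P (\<lambda>\<eta> \<omega>. L2_inner D (\<lambda>x. (u\<^sub>\<eta> \<eta> \<omega> x - u x) / \<eta>) u_m)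
              Q (\<lambda>v. 1 / (lam - lam_m) * noise_integral D W \<sigma> u_m v))"
proof -
  have blA: "L2_bounded_linear D A" and saA: "L2_self_adjoint D A"
    using assms(3,4) by (auto simp: L2_compact_def)
  have bl: "L2_bounded_linear D (A\<^sub>\<eta> \<eta> \<omega>)" and sa: "L2_self_adjoint D (A\<^sub>\<eta> \<eta> \<omega>)"
    and ev: "L2_eigen D (A\<^sub>\<eta> \<eta> \<omega>) (lam\<^sub>\<eta> \<eta> \<omega>) (u\<^sub>\<eta> \<eta> \<omega>)"
    if "\<eta> > 0" "\<omega> \<in> space P" for \<eta> \<omega>
    using assms(5,13)[OF that] by (auto simp: L2_compact_def)
  have u: "u \<in> L2 D" and Au: "A u \<in> L2 D"
    using assms(9) L2_bounded_linear_mem[OF blA] by (auto simp: L2_eigen_def)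
  have Q: "prob_space Q"
    using assms(15) by (simp add: white_noise_def)
  have D: "D \<in> sets lebesgue"
    using assms(1) by simp
  have uu: "L2_inner D u u = 1"
    using assms(10) L2_norm_square[of D u] by simp
  have u\<eta>: "u\<^sub>\<eta> \<eta> \<omega> \<in> L2 D" if "\<eta> > 0" "\<omega> \<in> space P" for \<eta> \<omega>
    using ev[OF that] by (simp add: L2_eigen_def)
  have A\<eta>u: "A\<^sub>\<eta> \<eta> \<omega> u \<in> L2 D" if "\<eta> > 0" "\<omega> \<in> space P" for \<eta> \<omega>
    using L2_bounded_linear_mem[OF bl[OF that] u] .

  define X where "X v \<eta> \<omega> = L2_inner D v (\<lambda>x. (A\<^sub>\<eta> \<eta> \<omega> u x - A u x) / \<eta>)" for v \<eta> \<omega>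
  have X_eq: "X v \<eta> \<omega> = L2_inner D v (\<lambda>x. A\<^sub>\<eta> \<eta> \<omega> u x - A u x) / \<eta>"
    if "v \<in> L2 D" "\<eta> > 0" "\<omega> \<in> space P" for v \<eta> \<omega>
    unfolding X_def using L2_inner_scale[OF that(1) L2_diff[OF A\<eta>u[OF that(2,3)] Au], of "1 / \<eta>"]
    by simp
  have X_meas: "X v \<eta> \<in> borel_measurable P" if "v \<in> L2 D" "\<eta> > 0" for v \<eta>
  proof -
    have "(\<lambda>\<omega>. L2_inner D v (A\<^sub>\<eta> \<eta> \<omega> u)) \<in> borel_measurable P"
      using assms(6)[OF that(2)] u that(1)
      by (simp add: L2_random_operator_def L2_random_element_def)
    then have "(\<lambda>\<omega>. (L2_inner D v (A\<^sub>\<eta> \<eta> \<omega> u) - L2_inner D v (A u)) / \<eta>) \<in> borel_measurable P"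
      by simp
    then show ?thesis
      by (rule measurable_cong[THEN iffD1, rotated])
         (simp add: X_eq that L2_inner_diff A\<eta>u Au)
  qed

  have driving: "conv_in_distr_0 P (X v) Q (noise_integral D W \<sigma> v)"
    and noise_meas: "noise_integral D W \<sigma> v \<in> borel_measurable Q"
    if v: "L2_eigen D A m v" for m v
  proof -
    obtain M where M: "M \<in> Smooth" "L2_eq D v M"
      using assms(19)[OF v] by blast
    have "M \<in> L2 D" "v \<in> L2 D"
      using M assms(16) v by (auto simp: L2_eigen_def)
    have noise: "noise_integral D W \<sigma> v = noise_integral D W \<sigma> M"
      by (simp add: noise_integral_def kernel_integral_cong[OF D M(2)])
    show "noise_integral D W \<sigma> v \<in> borel_measurable Q"
      unfolding noise unfolding noise_integral_def
      using assms(17)[OF M(1)]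
      by (intro white_noise_measurable[OF assms(15)]) (simp add: kernel_integrand_ok_def)
    have X_cong: "X v \<eta> \<omega> = X M \<eta> \<omega>" if "\<eta> > 0" "\<omega> \<in> space P" for \<eta> \<omega>
      using L2_inner_cong[OF \<open>v \<in> L2 D\<close> \<open>M \<in> L2 D\<close> L2_diff[OF A\<eta>u[OF that] Au] M(2)]
      by (simp add: X_eq[OF _ that] \<open>v \<in> L2 D\<close> \<open>M \<in> L2 D\<close> L2_inner_commute)
    have "conv_in_distr_0 P (X M) Q (noise_integral D W \<sigma> M)"
      using assms(18)[OF M(1)] by (simp add: X_def[abs_def])
    moreover have "distr P borel (X v \<eta>) = distr P borel (X M \<eta>)" if "\<eta> > 0" for \<eta>
      using that by (intro distr_cong) (auto simp: X_cong)
    ultimately show "conv_in_distr_0 P (X v) Q (noise_integral D W \<sigma> v)"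
      by (simp add: conv_in_distr_0_def noise)
  qed

  \<comment> \<open>the random part of the second-order remainder\<close>
  define E where "E \<eta> \<omega> = \<bar>lam - lam\<^sub>\<eta> \<eta> \<omega>\<bar>\<^sup>2 + (L2_norm D (\<lambda>x. u\<^sub>\<eta> \<eta> \<omega> x - u x))\<^sup>2
      + (L2_opnorm D (\<lambda>f x. A\<^sub>\<eta> \<eta> \<omega> f x - A f x))\<^sup>2" for \<eta> \<omega>
  obtain C1 C2 where
    C1: "\<forall>\<eta>>0. integrable P (\<lambda>\<omega>. (L2_opnorm D (\<lambda>f x. A\<^sub>\<eta> \<eta> \<omega> f x - A f x))\<^sup>2) \<and>
           (LINT \<omega>|P. (L2_opnorm D (\<lambda>f x. A\<^sub>\<eta> \<eta> \<omega> f x - A f x))\<^sup>2) \<le> C1 * \<eta>\<^sup>2" and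
    C2: "\<forall>\<eta>>0. integrable P (\<lambda>\<omega>. \<bar>lam - lam\<^sub>\<eta> \<eta> \<omega>\<bar>\<^sup>2) \<and>
           integrable P (\<lambda>\<omega>. (L2_norm D (\<lambda>x. u\<^sub>\<eta> \<eta> \<omega> x - u x))\<^sup>2) \<and>
           (LINT \<omega>|P. \<bar>lam - lam\<^sub>\<eta> \<eta> \<omega>\<bar>\<^sup>2) +
             (LINT \<omega>|P. (L2_norm D (\<lambda>x. u\<^sub>\<eta> \<eta> \<omega> x - u x))\<^sup>2) \<le> C2 * \<eta>\<^sup>2"
    using assms(8,14) by (elim exE) rule
  have E_int: "integrable P (E \<eta>)"
    and E_le: "(LINT \<omega>|P. E \<eta> \<omega>) \<le> (C1 + C2) * \<eta>\<^sup>2" if "\<eta> > 0" for \<eta>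
    using C1[rule_format, OF that] C2[rule_format, OF that]
    by (simp_all add: E_def[abs_def] distrib_right del: power2_abs)

  \<comment> \<open>Both limits follow from this: \<open>Y\<close> is, up to the factor \<open>c\<close>, the first-order part of the
    identity divided by \<open>\<eta>\<close>, and differs from \<open>c * X v\<close> only by the remainder.\<close>
  have transfer: "conv_in_distr_0 P Y Q (\<lambda>z. c * noise_integral D W \<sigma> v z)"
    if v: "L2_eigen D A m v"
      and Y: "\<And>\<eta>. \<eta> > 0 \<Longrightarrow> Y \<eta> \<in> borel_measurable P"
      and Y_eq: "\<And>\<eta> \<omega>. \<eta> > 0 \<Longrightarrow> \<omega> \<in> space P \<Longrightarrow> \<eta> * Y \<eta> \<omega> =
        c * ((lam\<^sub>\<eta> \<eta> \<omega> - lam) * L2_inner D v u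
             + (lam - m) * L2_inner D v (\<lambda>x. u\<^sub>\<eta> \<eta> \<omega> x - u x))"
    for m v Y c
  proof (rule conv_in_distr_0_scale_perturb[OF assms(2) Q X_meas Y noise_meas[OF v] driving[OF v],
        where G = "\<lambda>\<eta> \<omega>. \<bar>c\<bar> * L2_norm D v * E \<eta> \<omega>" and K = "\<bar>c\<bar> * L2_norm D v * (C1 + C2)"])
    show vL2: "v \<in> L2 D"
      using v by (simp add: L2_eigen_def)
    fix \<eta> :: real assume "\<eta> > 0"
    show "integrable P (\<lambda>\<omega>. \<bar>c\<bar> * L2_norm D v * E \<eta> \<omega>)"
      using E_int[OF \<open>\<eta> > 0\<close>] by simp
    show "(LINT \<omega>|P. \<bar>c\<bar> * L2_norm D v * E \<eta> \<omega>) \<le> \<bar>c\<bar> * L2_norm D v * (C1 + C2) * \<eta>\<^sup>2"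
      using mult_left_mono[OF E_le[OF \<open>\<eta> > 0\<close>], of "\<bar>c\<bar> * L2_norm D v"]
      by (simp add: L2_norm_nonneg mult.assoc)
    fix \<omega> assume "\<omega> \<in> space P"
    note * = \<open>\<eta> > 0\<close> \<open>\<omega> \<in> space P\<close>
    let ?L = "(lam\<^sub>\<eta> \<eta> \<omega> - lam) * L2_inner D v u
        + (lam - m) * L2_inner D v (\<lambda>x. u\<^sub>\<eta> \<eta> \<omega> x - u x)"
    have "\<eta> * \<bar>Y \<eta> \<omega> - c * X v \<eta> \<omega>\<bar> = \<bar>\<eta> * Y \<eta> \<omega> - c * (\<eta> * X v \<eta> \<omega>)\<bar>"
      using \<open>\<eta> > 0\<close> by (simp add: abs_mult_pos' right_diff_distrib mult_ac)
    also have "\<dots> = \<bar>c\<bar> * \<bar>?L - L2_inner D v (\<lambda>x. A\<^sub>\<eta> \<eta> \<omega> u x - A u x)\<bar>"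
      using \<open>\<eta> > 0\<close> unfolding Y_eq[OF *] X_eq[OF vL2 *]
      by (simp add: right_diff_distrib[symmetric] abs_mult)
    also have "\<dots> \<le> \<bar>c\<bar> * (L2_norm D v * E \<eta> \<omega>)"
      unfolding E_def
      by (intro mult_left_mono L2_eigen_perturbation_remainder bl sa ev blA saA assms(9) v *) simp
    finally show "\<eta> * \<bar>Y \<eta> \<omega> - c * X v \<eta> \<omega>\<bar> \<le> \<bar>c\<bar> * L2_norm D v * E \<eta> \<omega>"
      by (simp add: mult.assoc)
  qed

  show ?thesis
  proof (intro conjI allI impI)
    have "conv_in_distr_0 P (\<lambda>\<eta> \<omega>. (lam\<^sub>\<eta> \<eta> \<omega> - lam) / \<eta>) Q (\<lambda>z. 1 * noise_integral D W \<sigma> u z)"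
    proof (rule transfer[OF assms(9)])
      show "(\<lambda>\<omega>. (lam\<^sub>\<eta> \<eta> \<omega> - lam) / \<eta>) \<in> borel_measurable P" if "\<eta> > 0" for \<eta>
        using assms(11)[OF that] by simp
    qed (simp add: uu)
    then show "conv_in_distr_0 P (\<lambda>\<eta> \<omega>. (lam\<^sub>\<eta> \<eta> \<omega> - lam) / \<eta>) Q (noise_integral D W \<sigma> u)"
      by simp
  next
    fix m v assume "L2_eigen D A m v \<and> m \<noteq> lam"
    then have v: "L2_eigen D A m v" and "m \<noteq> lam" by auto
    then have vL2: "v \<in> L2 D" by (simp add: L2_eigen_def)
    have vu: "L2_inner D v u = 0"
      by (rule L2_eigen_orthogonal[OF blA saA assms(9) v \<open>m \<noteq> lam\<close>])
    have eq: "L2_inner D (\<lambda>x. (u\<^sub>\<eta> \<eta> \<omega> x - u x) / \<eta>) v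
        = L2_inner D v (\<lambda>x. u\<^sub>\<eta> \<eta> \<omega> x - u x) / \<eta>" if "\<eta> > 0" "\<omega> \<in> space P" for \<eta> \<omega>
      using L2_inner_scale[OF vL2 L2_diff[OF u\<eta>[OF that] u], of "1 / \<eta>"]
      by (simp add: L2_inner_commute)
    show "conv_in_distr_0 P (\<lambda>\<eta> \<omega>. L2_inner D (\<lambda>x. (u\<^sub>\<eta> \<eta> \<omega> x - u x) / \<eta>) v)
        Q (\<lambda>z. 1 / (lam - m) * noise_integral D W \<sigma> v z)"
    proof (rule transfer[OF v])
      fix \<eta> :: real assume "\<eta> > 0"
      have "(\<lambda>\<omega>. L2_inner D v (u\<^sub>\<eta> \<eta> \<omega>)) \<in> borel_measurable P"
        using assms(12)[OF \<open>\<eta> > 0\<close>] vL2 by (simp add: L2_random_element_def)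
      then have "(\<lambda>\<omega>. (L2_inner D v (u\<^sub>\<eta> \<eta> \<omega>) - L2_inner D v u) / \<eta>) \<in> borel_measurable P"
        by simp
      then show "(\<lambda>\<omega>. L2_inner D (\<lambda>x. (u\<^sub>\<eta> \<eta> \<omega> x - u x) / \<eta>) v) \<in> borel_measurable P"
        by (rule measurable_cong[THEN iffD1, rotated])
           (simp add: eq \<open>\<eta> > 0\<close> L2_inner_diff vL2 u u\<eta>)
    next
      fix \<eta> :: real and \<omega> assume "\<eta> > 0" "\<omega> \<in> space P"
      then show "\<eta> * L2_inner D (\<lambda>x. (u\<^sub>\<eta> \<eta> \<omega> x - u x) / \<eta>) v = 1 / (lam - m) *
          ((lam\<^sub>\<eta> \<eta> \<omega> - lam) * L2_inner D v u
             + (lam - m) * L2_inner D v (\<lambda>x. u\<^sub>\<eta> \<eta> \<omega> x - u x))"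
        using \<open>m \<noteq> lam\<close> by (simp add: eq vu)
    qed
  qed
qed

end
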